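(* Let $S$ be a finite set, $\mu$ a probability mass function on $S$, $r:S\to\mathbb{R}$, and $(P_i(\epsilon):i\ge1,\epsilon>0)$ a family of stochastic matrices on $S$. Suppose that the positive integer $n=n(\epsilon)$ is such that $n/\log(1/\epsilon)\to\infty$ as $\epsilon\downarrow0$. For a function $a(\epsilon)$ with $a(\epsilon)\to\infty$ as $\epsilon\downarrow0$, let $m=m(\epsilon)=\lfloor\min(n/2,\,a(\epsilon)\log(1/\epsilon))\rfloor$. Assume there exist matrices $\tilde P,\tilde P^{(1)}$ (not depending on $\epsilon$) for which $$\sup_{0\le k\le m}\|P_{n-k}(\epsilon)-(\tilde P-\epsilon k\tilde P^{(1)})\|=O(\epsilon^2m^2)$$ as $\epsilon\downarrow0$, where $\tilde P$ is an irreducible and aperiodic stochastic matrix. Then $$\mu\prod_{k=1}^{n}P_k(\epsilon)\,r=\tilde\pi r-\epsilon\tilde\pi\tilde P^{(1)}(I-\tilde P+\tilde\Pi)^{-2}\tilde Pr+O(\epsilon^2m^3)$$ as $\epsilon\downarrow0$, where $\tilde\pi$ is the stationary distribution of $\tilde P$ and $\tilde\Pi$ is the rank one matrix having rows identical to $\tilde\pi$.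
   Context: Matrix products are taken in increasing order of index, $\prod_{k=1}^nP_k=P_1P_2\cdots P_n$. The matrix norm is $\|A\|=\max_x\sum_y|A(x,y)|$. Probability mass functions are row vectors and functions on $S$ are column vectors. *)

theory Defs
  imports "HOL-Analysis.Analysis" "HOL-Library.Landau_Symbols"
begin

text \<open>
  The state space is a type of class \<open>finite\<close>. A matrix on it is \<open>A :: real ^ 's ^ 's\<close>, with
  entry \<open>A(x, y)\<close> written \<open>A $ x $ y\<close>. A row vector \<open>v\<close> acts from the left as \<open>v v* A\<close>, and
  the pairing of a row vector with a column vector is the inner product.
\<close>

definition prob_vector :: "real ^ 's::finite \<Rightarrow> bool" where
  "prob_vector v \<longleftrightarrow> (\<forall>x. 0 \<le> v $ x) \<and> (\<Sum>x\<in>UNIV. v $ x) = 1"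

definition stochastic :: "real ^ 's ^ 's::finite \<Rightarrow> bool" where
  "stochastic A \<longleftrightarrow> (\<forall>x. prob_vector (A $ x))"

text \<open>
  The class norm of \<open>real ^ 's ^ 's\<close> is the Euclidean norm of the entries, hence a separate constant.
\<close>

definition matrix_norm :: "real ^ 's ^ 's::finite \<Rightarrow> real" where
  "matrix_norm A = (MAX x. \<Sum>y\<in>UNIV. \<bar>A $ x $ y\<bar>)"

text \<open>\<open>matrix_prod A n = A 1 ** A 2 ** \<dots> ** A n\<close>.\<close>

primrec matrix_prod :: "(nat \<Rightarrow> real ^ 's ^ 's::finite) \<Rightarrow> nat \<Rightarrow> real ^ 's ^ 's" where
  "matrix_prod A 0 = mat 1"
| "matrix_prod A (Suc n) = matrix_prod A n ** A (Suc n)"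

text \<open>
  The operator \<open>^\<close> on \<open>real ^ 's ^ 's\<close> takes powers entrywise, so it is not the matrix power.
\<close>

definition matrix_power :: "real ^ 's ^ 's::finite \<Rightarrow> nat \<Rightarrow> real ^ 's ^ 's" where
  "matrix_power A t = matrix_prod (\<lambda>_. A) t"

definition irreducible_matrix :: "real ^ 's ^ 's::finite \<Rightarrow> bool" where
  "irreducible_matrix A \<longleftrightarrow> (\<forall>x y. \<exists>t. matrix_power A t $ x $ y > 0)"

definition period :: "real ^ 's ^ 's::finite \<Rightarrow> 's \<Rightarrow> nat" where
  "period A x = Gcd {t. t \<ge> 1 \<and> matrix_power A t $ x $ x > 0}"

definition aperiodic_matrix :: "real ^ 's ^ 's::finite \<Rightarrow> bool" where
  "aperiodic_matrix A \<longleftrightarrow> (\<forall>x. period A x = 1)"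

definition stationary_distribution :: "real ^ 's ^ 's::finite \<Rightarrow> real ^ 's" where
  "stationary_distribution A = (THE p. prob_vector p \<and> p v* A = p)"

definition rank_one_rows :: "real ^ 's::finite \<Rightarrow> real ^ 's ^ 's" where
  "rank_one_rows v = (\<chi> x. v)"

end

theory Submission
  imports Defs
begin

text \<open>
  Let \<open>y k\<close> be the law after the first \<open>n - k\<close> factors. Replacing the last \<open>m + 1\<close> factors by
  \<open>A\<close>, the limit matrix, one at a time gives
  \<open>y 0 = y (m+1) A^(m+1) + (\<Sum>k\<le>m. y (k+1) (P (n-k) - A) A^k)\<close>.
  Geometric ergodicity (a contraction for a strictly positive power of \<open>A\<close>) and
  \<open>m / log (1/\<epsilon>) \<rightarrow> \<infinity>\<close> make \<open>y (m+1) A^(m+1)\<close> equal to \<open>\<pi>\<close> up to \<open>O(\<epsilon>^2)\<close>.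
  When \<open>P1 1 = 0\<close>, only \<open>W k = A^k - \<Pi>\<close>, which decays geometrically, survives behind \<open>P1\<close>, and
  \<open>y (k+1)\<close> may be replaced by \<open>\<pi>\<close> by the same telescoping. The remaining sum \<open>\<Sum>k\<le>m. k W k\<close> is
  summed by parts with \<open>M = I - A + \<Pi>\<close>, which satisfies \<open>M W k = W k - W (k+1)\<close>; this produces
  the factor \<open>M^(-2)\<close>. When \<open>P1 1 \<noteq> 0\<close>, the hypothesis forces \<open>\<epsilon> m\<close> to be bounded below, and the
  error term absorbs everything.
\<close>

subsection \<open>Numerical semigroups\<close>

text \<open>Applied to the return times of a state, this turns period 1 into a positive return
  probability at all late times. The core is to find two consecutive elements of \<open>S\<close>;
  their nonnegative combinations cover all large numbers.\<close>

lemma closed_add_Gcd_1_eventually: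
  fixes S :: "nat set"
  assumes add: "\<And>a b. a \<in> S \<Longrightarrow> b \<in> S \<Longrightarrow> a + b \<in> S"
    and gcd: "Gcd S = 1"
  shows "\<exists>N. \<forall>n\<ge>N. n \<in> S"
proof -
  have mult: "q * s \<in> S" if "q \<ge> 1" "s \<in> S" for q s
    using that by (induction q rule: dec_induct) (auto intro: add)
  (* The least positive difference d of two elements of S divides every element of S, so d = 1. *)
  define G where "G d \<longleftrightarrow> d > 0 \<and> (\<exists>s\<in>S. s + d \<in> S)" for d
  obtain s0 where s0: "s0 \<in> S" "s0 > 0"
    using gcd by (metis Gcd_0_iff gr0I one_neq_zero singleton_iff subsetI)
  then have "G s0" using add G_def by blast
  define d where "d = (LEAST d. G d)"
  have "G d" unfolding d_def using \<open>G s0\<close> by (rule LeastI)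
  then obtain s where s: "s \<in> S" "s + d \<in> S" and d: "d > 0" by (auto simp: G_def)
  have "d dvd t" if "t \<in> S" for t
  proof (rule ccontr)
    assume nd: "\<not> d dvd t"
    let ?q = "t div d"
    \<comment> \<open>This element and \<open>t + Suc ?q * s\<close>, also in \<open>S\<close>,
      differ by exactly \<open>t mod d\<close>, which would be a positive difference smaller than
      \<open>d\<close>.\<close>
    have le: "?q * (s + d) + s \<in> S"
    proof (cases "?q = 0")
      case False
      then have "?q \<ge> 1" by simp
      then show ?thesis using mult s add by blast
    qed (use s in auto)
    have "?q * (s + d) + s + t mod d = t + Suc ?q * s"
      by (simp add: algebra_simps)
    also have "\<dots> \<in> S" using mult[of "Suc ?q" s] s add that by simp
    finally have "G (t mod d)" using le nd unfolding G_def by (metis mod_greater_zero_iff_not_dvd)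
    then have "d \<le> t mod d" unfolding d_def by (rule Least_le)
    then show False using d by (meson mod_less_divisor not_le)
  qed
  then have "d dvd Gcd S" by (simp add: Gcd_greatest)
  then have d1: "d = 1" using gcd by simp
  show ?thesis
  proof (intro exI allI impI)
    \<comment> \<open>Division by \<open>s\<close> with quotient q and remainder r gives n = (q - r)
      s + r (s + 1), and n at least s^2 keeps q - r positive. The successors in the bound force n to
      be at least 1 when \<open>s = 0\<close>.\<close>
    fix n assume n: "n \<ge> Suc s * Suc s"
    show "n \<in> S"
    proof (cases "s = 0")
      case True
      then show ?thesis using mult[of n 1] s d1 n by simp
    next
      case False
      let ?q = "n div s" and ?r = "n mod s"
      have r: "?r < s" using False by simp
      have "s * s \<le> n" using n by simp
      then have q: "s \<le> ?q" using False by (simp add: less_eq_div_iff_mult_less_eq)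
      then have "?q - ?r \<ge> 1" using r by linarith
      then have 1: "(?q - ?r) * s \<in> S" using mult s by blast
      have eq: "n = (?q - ?r) * s + ?r * (s + 1)"
      proof -
        have "(?q - ?r) * s + ?r * (s + 1) = ((?q - ?r) + ?r) * s + ?r"
          by (simp add: algebra_simps)
        also have "\<dots> = n" using q r by simp
        finally show ?thesis by simp
      qed
      show ?thesis
      proof (cases "?r = 0")
        case True then show ?thesis using 1 eq by simp
      next
        case False
        then have "?r * (s + 1) \<in> S" using mult[of ?r "s + 1"] s d1 by simp
        then show ?thesis using 1 add eq by metis
      qed
    qed
  qed
qed

subsection \<open>The matrix norm and stochastic matrices\<close>

text \<open>The norm on row vectors for which \<open>matrix_norm A\<close> is the operator norm of
  the action \<open>v v* A\<close>.\<close>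

definition l1_norm :: "real ^ 's::finite \<Rightarrow> real" where
  "l1_norm v = (\<Sum>x\<in>UNIV. \<bar>v $ x\<bar>)"

lemma l1_norm_nonneg [simp]: "0 \<le> l1_norm v"
  by (simp add: l1_norm_def sum_nonneg)

lemma l1_norm_eq_0_iff: "l1_norm v = 0 \<longleftrightarrow> v = 0"
  by (simp add: l1_norm_def sum_nonneg_eq_0_iff vec_eq_iff)

lemma l1_norm_0 [simp]: "l1_norm 0 = 0"
  by (simp add: l1_norm_def)

lemma l1_norm_add: "l1_norm (v + w) \<le> l1_norm v + l1_norm w"
  unfolding l1_norm_def sum.distrib[symmetric] by (intro sum_mono) simp

lemma l1_norm_diff: "l1_norm (v - w) \<le> l1_norm v + l1_norm w"
  unfolding l1_norm_def sum.distrib[symmetric] by (intro sum_mono) simp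

lemma l1_norm_scaleR: "l1_norm (c *\<^sub>R v) = \<bar>c\<bar> * l1_norm v"
  by (simp add: l1_norm_def abs_mult sum_distrib_left)

lemma l1_norm_sum: "l1_norm (\<Sum>i\<in>I. f i) \<le> (\<Sum>i\<in>I. l1_norm (f i))"
proof (induction I rule: infinite_finite_induct)
  case (insert i I)
  then show ?case using l1_norm_add[of "f i" "\<Sum>i\<in>I. f i"] by simp
qed simp_all

lemma abs_inner_le_l1_norm: "\<bar>v \<bullet> r\<bar> \<le> l1_norm v * norm r"
proof -
  have "\<bar>v \<bullet> r\<bar> \<le> (\<Sum>x\<in>UNIV. \<bar>v $ x * r $ x\<bar>)"
    unfolding inner_vec_def inner_real_def by (rule sum_abs)
  also have "\<dots> \<le> (\<Sum>x\<in>UNIV. \<bar>v $ x\<bar> * norm r)"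
    unfolding abs_mult by (intro sum_mono mult_left_mono component_le_norm_cart) auto
  finally show ?thesis by (simp add: l1_norm_def sum_distrib_right)
qed

lemma l1_norm_row_le: "l1_norm (A $ x) \<le> matrix_norm A"
  unfolding l1_norm_def matrix_norm_def by (intro Max_ge) auto

lemma matrix_norm_le: "(\<And>x. l1_norm (A $ x) \<le> c) \<Longrightarrow> matrix_norm A \<le> c"
  unfolding l1_norm_def matrix_norm_def by (subst Max_le_iff) auto

lemma matrix_norm_nonneg [simp]: "0 \<le> matrix_norm A"
  using l1_norm_row_le l1_norm_nonneg by (rule order_trans[rotated])

lemma l1_norm_vector_matrix: "l1_norm (v v* A) \<le> l1_norm v * matrix_norm A"
proof -
  have "l1_norm (v v* A) \<le> (\<Sum>y\<in>UNIV. \<Sum>x\<in>UNIV. \<bar>v $ x * A $ x $ y\<bar>)"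
    unfolding l1_norm_def vector_matrix_mult_def by (auto intro!: sum_mono sum_abs)
  also have "\<dots> = (\<Sum>x\<in>UNIV. \<bar>v $ x\<bar> * l1_norm (A $ x))"
    by (subst sum.swap) (simp add: abs_mult l1_norm_def sum_distrib_left)
  also have "\<dots> \<le> (\<Sum>x\<in>UNIV. \<bar>v $ x\<bar> * matrix_norm A)"
    by (intro sum_mono mult_left_mono l1_norm_row_le) auto
  finally show ?thesis by (simp add: l1_norm_def sum_distrib_right)
qed

lemma vector_matrix_mult_sum_right: "v v* (\<Sum>i\<in>I. f i) = (\<Sum>i\<in>I. v v* f i)"
  for v :: "real ^ 's"
  by (induction I rule: infinite_finite_induct) (auto simp: vector_matrix_mult_add_rdistrib)

section \<open>Stochastic matrices and their powers\<close>

lemma prob_vector_l1_norm: "prob_vector v \<Longrightarrow> l1_norm v = 1"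
  by (simp add: prob_vector_def l1_norm_def)

lemma prob_vector_inner_1: "prob_vector v \<Longrightarrow> v \<bullet> 1 = 1"
  by (simp add: prob_vector_def inner_vec_def)

lemma stochastic_mult_1: "stochastic A \<Longrightarrow> A *v 1 = 1"
  by (simp add: stochastic_def prob_vector_def matrix_vector_mult_def vec_eq_iff)

lemma matrix_norm_stochastic: "stochastic A \<Longrightarrow> matrix_norm A \<le> 1"
  by (intro matrix_norm_le) (simp add: stochastic_def prob_vector_l1_norm)

lemma l1_norm_vector_stochastic: "stochastic A \<Longrightarrow> l1_norm (v v* A) \<le> l1_norm v"
  using l1_norm_vector_matrix[of v A] matrix_norm_stochastic[of A]
    mult_left_mono[of "matrix_norm A" 1 "l1_norm v"] by simp

lemma prob_vector_mult:
  assumes "prob_vector v" "stochastic A"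
  shows "prob_vector (v v* A)"
proof -
  have "(v v* A) \<bullet> 1 = 1"
    using assms by (simp add: dot_lmul_matrix stochastic_mult_1 prob_vector_inner_1)
  then show ?thesis using assms
    by (auto simp: prob_vector_def inner_vec_def stochastic_def vector_matrix_mult_def intro!: sum_nonneg)
qed

lemma matrix_mult_row: "(A ** B) $ x = A $ x v* B"
  by (simp add: matrix_matrix_mult_def vector_matrix_mult_def vec_eq_iff)

lemma stochastic_mult: "stochastic A \<Longrightarrow> stochastic B \<Longrightarrow> stochastic (A ** B)"
  by (simp add: stochastic_def matrix_mult_row prob_vector_mult)

lemma stochastic_mat_1: "stochastic (mat 1)"
  by (simp add: stochastic_def prob_vector_def mat_def)

lemma matrix_power_0 [simp]: "matrix_power A 0 = mat 1"
  by (simp add: matrix_power_def)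

lemma matrix_power_Suc: "matrix_power A (Suc t) = matrix_power A t ** A"
  by (simp add: matrix_power_def)

lemma matrix_power_add: "matrix_power A (s + t) = matrix_power A s ** matrix_power A t"
  by (induction t) (auto simp: matrix_power_Suc matrix_mul_assoc)

lemma matrix_power_Suc': "matrix_power A (Suc t) = A ** matrix_power A t"
  using matrix_power_add[of A 1 t] by (simp add: matrix_power_Suc)

lemma stochastic_matrix_power: "stochastic A \<Longrightarrow> stochastic (matrix_power A t)"
  by (induction t) (auto simp: matrix_power_Suc stochastic_mult stochastic_mat_1)

lemma stochastic_nonneg: "stochastic A \<Longrightarrow> 0 \<le> A $ x $ y"
  by (simp add: stochastic_def prob_vector_def)

lemma matrix_power_pos_add:
  assumes "stochastic A" "matrix_power A s $ x $ z > 0" "matrix_power A t $ z $ y > 0"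
  shows "matrix_power A (s + t) $ x $ y > 0"
  unfolding matrix_power_add matrix_matrix_mult_def
  using assms stochastic_matrix_power[OF assms(1)]
  by (auto intro!: sum_pos2[of _ z] simp: stochastic_nonneg)

subsection \<open>Geometric ergodicity\<close>

text \<open>From some time on, every state x can return to itself at every time. To reach y at time
  \<open>M\<close>, return to x at time \<open>M - t x y\<close> and then follow a path of length
  \<open>t x y\<close>. There are finitely many pairs, so one \<open>M\<close> serves them
  all.\<close>

lemma irreducible_aperiodic_imp_positive_power:
  assumes A: "stochastic A" "irreducible_matrix A" "aperiodic_matrix A"
  obtains N where "N \<ge> 1" "\<And>x y. matrix_power A N $ x $ y > 0"
proof -
  have "\<exists>N. \<forall>n\<ge>N. n \<in> {t. t \<ge> 1 \<and> matrix_power A t $ x $ x > 0}" for x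
    using A(1,3) by (intro closed_add_Gcd_1_eventually)
      (auto simp: aperiodic_matrix_def period_def intro: matrix_power_pos_add)
  then obtain N where N: "\<And>x n. n \<ge> N x \<Longrightarrow> matrix_power A n $ x $ x > 0"
    by (simp add: choice_iff) metis
  obtain t where t: "\<And>x y. matrix_power A (t x y) $ x $ y > 0"
    using A(2) unfolding irreducible_matrix_def by metis
  define M where "M = Suc (Max (range (\<lambda>(x, y). N x + t x y)))"
  have "matrix_power A M $ x $ y > 0" for x y
  proof -
    have "N x + t x y \<le> M"
      unfolding M_def by (intro le_SucI Max_ge) (auto intro: rev_image_eqI[of "(x, y)"])
    then have "N x \<le> M - t x y" "M = (M - t x y) + t x y" by auto
    then show ?thesis using matrix_power_pos_add[OF A(1) N t] by metis
  qed
  then show ?thesis using that[of M] by (simp add: M_def)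
qed

(* Since v has total mass 0, v A = v (A - \<delta> J) with J the all-ones matrix, and A - \<delta> J is nonnegative. *)
lemma l1_norm_contraction:
  fixes A :: "real ^ 's ^ 's::finite"
  assumes A: "stochastic A" and \<delta>: "\<And>x y. \<delta> \<le> A $ x $ y" "\<delta> \<ge> 0" and v: "v \<bullet> 1 = 0"
  shows "l1_norm (v v* A) \<le> (1 - \<delta>) * l1_norm v"
proof -
  let ?J = "(\<chi> x y. \<delta>) :: real ^ 's ^ 's"
  have "v v* ?J = 0"
    using v by (simp add: vector_matrix_mult_def vec_eq_iff inner_vec_def sum_distrib_right[symmetric])
  then have "v v* A = v v* (A - ?J)" by (simp add: vector_matrix_mult_diff_rdistrib)
  moreover have "matrix_norm (A - ?J) \<le> 1 - \<delta>"
  proof (rule matrix_norm_le)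
    fix x
    have "l1_norm ((A - ?J) $ x) = (\<Sum>y\<in>UNIV. A $ x $ y - \<delta>)"
      using \<delta> by (simp add: l1_norm_def)
    also have "\<dots> = 1 - real CARD('s) * \<delta>"
      using A by (simp add: sum_subtractf stochastic_def prob_vector_def)
    also have "\<dots> \<le> 1 - 1 * \<delta>"
      using \<delta> by (intro diff_left_mono mult_right_mono) (auto simp: Suc_le_eq)
    finally show "l1_norm ((A - ?J) $ x) \<le> 1 - \<delta>" by simp
  qed
  ultimately show ?thesis
    using l1_norm_vector_matrix[of v "A - ?J"]
      mult_left_mono[of "matrix_norm (A - ?J)" "1 - \<delta>" "l1_norm v"]
    by (simp add: mult.commute)
qed

lemma inner_1_stochastic: "stochastic A \<Longrightarrow> (v v* A) \<bullet> 1 = v \<bullet> 1"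
  by (simp add: dot_lmul_matrix stochastic_mult_1)

text \<open>Each block of \<open>N\<close> steps, with all entries of the power at least \<delta>,
  contracts vectors of mass 0 by q = 1 - \<delta>, and the incomplete block does not increase the
  norm. Taking \<rho> as the \<open>N\<close>-th root of q gives a rate per step; the factor 1/q
  pays for the incomplete block.\<close>

lemma l1_norm_geometric_decay:
  assumes A: "stochastic A" "irreducible_matrix A" "aperiodic_matrix A"
  obtains C \<rho> where "C > 0" "0 < \<rho>" "\<rho> < 1"
    "\<And>v k. v \<bullet> 1 = 0 \<Longrightarrow> l1_norm (v v* matrix_power A k) \<le> C * \<rho> ^ k * l1_norm v"
proof -
  obtain N where N: "N \<ge> 1" "\<And>x y. matrix_power A N $ x $ y > 0"
    using irreducible_aperiodic_imp_positive_power[OF A] by blast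
  \<comment> \<open>The cap 1/2 keeps \<open>q\<close> positive when there is a single state, whose
    only entry is 1.\<close>
  define \<delta> where "\<delta> = min (1/2) (Min (range (\<lambda>(x, y). matrix_power A N $ x $ y)))"
  have \<delta>0: "\<delta> > 0" unfolding \<delta>_def using N by (auto simp: Min_gr_iff)
  have \<delta>1: "\<delta> \<le> 1/2" by (simp add: \<delta>_def)
  have \<delta>A: "\<delta> \<le> matrix_power A N $ x $ y" for x y
    unfolding \<delta>_def by (intro min.coboundedI2 Min_le) (auto intro: rev_image_eqI[of "(x, y)"])
  define q where "q = 1 - \<delta>"
  have q: "0 < q" "q < 1" using \<delta>0 \<delta>1 by (auto simp: q_def)
  define \<rho> where "\<rho> = q powr (1 / real N)"
  have \<rho>: "0 < \<rho>" "\<rho> < 1" using q N(1) powr_less_mono2[of "1 / real N" q 1] by (auto simp: \<rho>_def)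
  have step: "l1_norm (v v* matrix_power A (j * N)) \<le> q ^ j * l1_norm v" if "v \<bullet> 1 = 0" for v j
  proof (induction j)
    case (Suc j)
    have "matrix_power A (Suc j * N) = matrix_power A (j * N) ** matrix_power A N"
      using matrix_power_add[of A "j * N" N] by (simp add: add.commute)
    then have "l1_norm (v v* matrix_power A (Suc j * N)) \<le> q * l1_norm (v v* matrix_power A (j * N))"
      using l1_norm_contraction[of "matrix_power A N" \<delta> "v v* matrix_power A (j * N)"] A(1) \<delta>0 \<delta>A that
      by (simp add: q_def stochastic_matrix_power inner_1_stochastic less_imp_le vector_matrix_mul_assoc)
    also have "\<dots> \<le> q * (q ^ j * l1_norm v)" using Suc q by (intro mult_left_mono) auto
    finally show ?case by (simp add: mult.assoc)
  qed simp
  have "l1_norm (v v* matrix_power A k) \<le> (1 / q) * \<rho> ^ k * l1_norm v" if "v \<bullet> 1 = 0" for v k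
  proof -
    have "matrix_power A k = matrix_power A ((k div N) * N) ** matrix_power A (k mod N)"
      by (simp flip: matrix_power_add)
    then have "l1_norm (v v* matrix_power A k) \<le> l1_norm (v v* matrix_power A ((k div N) * N))"
      using l1_norm_vector_stochastic[OF stochastic_matrix_power[OF A(1)]]
      by (metis vector_matrix_mul_assoc)
    also have "\<dots> \<le> q ^ (k div N) * l1_norm v" using step[OF that] .
    also have "q ^ (k div N) \<le> (1 / q) * \<rho> ^ k"
    proof -
      have "k \<le> (k div N + 1) * N"
        using N(1) dividend_less_div_times[of N k] by simp
      then have "real k \<le> (real (k div N) + 1) * real N"
        by (metis of_nat_1 of_nat_add of_nat_le_iff of_nat_mult)
      then have "real k / real N \<le> real (k div N) + 1"
        using N(1) by (simp add: divide_le_eq)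
      then have "q powr (real (k div N) + 1) \<le> q powr (real k / real N)"
        using q by (intro powr_mono') auto
      moreover have "q powr (real (k div N) + 1) = q * q ^ (k div N)"
        using q by (simp add: powr_add powr_realpow)
      moreover have "q powr (real k / real N) = \<rho> ^ k"
        using q by (simp add: \<rho>_def powr_realpow[symmetric] powr_powr)
      ultimately show ?thesis using q by (simp add: field_simps)
    qed
    finally show ?thesis by (simp add: mult_right_mono)
  qed
  then show ?thesis using that[of "1 / q" \<rho>] q \<rho> by simp
qed

text \<open>Brouwer's fixed point theorem for the action of \<open>A\<close> on the compact convex
  simplex of probability vectors.\<close>

lemma stationary_vector_exists:
  fixes A :: "real ^ 's ^ 's::finite"
  assumes "stochastic A"
  obtains p where "prob_vector p" "p v* A = p"
proof -
  let ?S = "{v :: real ^ 's. prob_vector v}"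
  have S: "?S = (\<Inter>x. {v. 0 \<le> v $ x}) \<inter> {v. (\<Sum>x\<in>UNIV. v $ x) = 1}"
    by (auto simp: prob_vector_def)
  have "closed ?S" unfolding S
    by (intro closed_Int closed_INT closed_Collect_le closed_Collect_eq ballI continuous_intros)
  moreover have "bounded ?S"
  proof (rule boundedI)
    fix v :: "real ^ 's" assume "v \<in> ?S"
    then show "norm v \<le> 1"
      using norm_le_l1_cart[of v] by (simp add: prob_vector_def)
  qed
  ultimately have "compact ?S" by (simp add: compact_eq_bounded_closed)
  moreover have "convex ?S"
    by (auto simp: convex_def prob_vector_def sum.distrib sum_distrib_left[symmetric])
  moreover have "axis undefined 1 \<in> ?S"
    by (auto simp: prob_vector_def axis_def)
  moreover have "continuous_on ?S (\<lambda>v. v v* A)"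
    unfolding vector_matrix_mult_def by (intro continuous_intros)
  moreover have "(\<lambda>v. v v* A) ` ?S \<subseteq> ?S"
    using assms prob_vector_mult by blast
  ultimately obtain p where "p \<in> ?S" "p v* A = p"
    using brouwer[of ?S "\<lambda>v. v v* A"] by blast
  then show ?thesis using that by blast
qed

text \<open>Uniqueness is what makes the \<open>THE\<close> in
  \<open>stationary_distribution\<close> meaningful: the difference of two stationary vectors has
  mass 0 and is fixed by all powers of \<open>A\<close>, so geometric decay forces it to
  vanish.\<close>

lemma stationary_distribution_props:
  assumes A: "stochastic A" "irreducible_matrix A" "aperiodic_matrix A"
  shows "prob_vector (stationary_distribution A)"
    "stationary_distribution A v* A = stationary_distribution A"
proof -
  obtain p where p: "prob_vector p" "p v* A = p" using stationary_vector_exists[OF A(1)] .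
  obtain C \<rho> where C: "C > 0" "0 < \<rho>" "\<rho> < 1"
    "\<And>v k. v \<bullet> 1 = 0 \<Longrightarrow> l1_norm (v v* matrix_power A k) \<le> C * \<rho> ^ k * l1_norm v"
    using l1_norm_geometric_decay[OF A] by blast
  have "q = p" if "prob_vector q" "q v* A = q" for q
  proof -
    have 0: "(q - p) \<bullet> 1 = 0"
      using that p by (simp add: inner_diff_left prob_vector_inner_1)
    have fixed: "(q - p) v* matrix_power A k = q - p" for k
      by (induction k) (use that p in \<open>auto simp: matrix_power_Suc simp flip: vector_matrix_mul_assoc
          simp: vector_matrix_mult_diff_distrib\<close>)
    have "(\<lambda>k. C * \<rho> ^ k * l1_norm (q - p)) \<longlonglongrightarrow> C * 0 * l1_norm (q - p)"
      using C by (intro tendsto_intros) auto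
    then have "l1_norm (q - p) \<le> 0"
      using C(4)[OF 0] by (intro LIMSEQ_le_const) (auto simp: fixed)
    then show ?thesis using l1_norm_nonneg[of "q - p"] l1_norm_eq_0_iff[of "q - p"] by simp
  qed
  then have "\<exists>!q. prob_vector q \<and> q v* A = q" using p by blast
  from theI'[OF this] show "prob_vector (stationary_distribution A)"
    "stationary_distribution A v* A = stationary_distribution A"
    by (simp_all add: stationary_distribution_def)
qed

subsection \<open>Perturbation of an ergodic matrix\<close>

lemma matrix_diff_ldistrib: "A ** (B - C) = A ** B - A ** C"
  for A :: "real ^ 's ^ 't" and B C :: "real ^ 'u ^ 's"
  by (simp add: vec_eq_iff[where x = "A ** (B - C)"] matrix_mult_row vector_matrix_mult_diff_rdistrib)

lemma matrix_diff_rdistrib: "(A - B) ** C = A ** C - B ** C"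
  for A B :: "real ^ 's ^ 't" and C :: "real ^ 'u ^ 's"
  by (simp add: vec_eq_iff[where x = "(A - B) ** C"] matrix_mult_row vector_matrix_mult_diff_distrib)

lemma matrix_add_rdistrib: "(A + B) ** C = A ** C + B ** C"
  for A B :: "real ^ 's ^ 't" and C :: "real ^ 'u ^ 's"
  by (simp add: vec_eq_iff[where x = "(A + B) ** C"] matrix_mult_row vector_matrix_left_distrib)

lemma vector_rank_one_rows: "v v* rank_one_rows p = (v \<bullet> 1) *\<^sub>R p"
  by (simp add: vector_matrix_mult_def rank_one_rows_def vec_eq_iff inner_vec_def sum_distrib_right)

lemma rank_one_rows_mult: "rank_one_rows p ** A = rank_one_rows (p v* A)"
  by (rule vec_eq_iff[THEN iffD2]) (simp add: matrix_mult_row rank_one_rows_def)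

lemma stochastic_mult_rank_one_rows: "stochastic A \<Longrightarrow> A ** rank_one_rows p = rank_one_rows p"
  by (simp add: vec_eq_iff[where y = "rank_one_rows p"] matrix_mult_row vector_rank_one_rows
      stochastic_def prob_vector_inner_1) (simp add: rank_one_rows_def)

(* The index runs backwards in time: y k is the law k steps before the end, cf. P (n - k). *)
lemma product_telescope:
  assumes "\<And>k. k < K \<Longrightarrow> y k = y (Suc k) v* Q k"
  shows "y 0 = y K v* matrix_power A K
           + (\<Sum>k<K. (y (Suc k) v* (Q k - A)) v* matrix_power A k)"
  using assms
proof (induction K)
  case (Suc K)
  have "y K v* matrix_power A K = y (Suc K) v* matrix_power A (Suc K)
          + (y (Suc K) v* (Q K - A)) v* matrix_power A K"
    using Suc.prems[of K]
    by (simp add: vector_matrix_mult_diff_rdistrib vector_matrix_mult_diff_distrib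
        matrix_power_Suc' flip: vector_matrix_mul_assoc)
  then show ?case using Suc by simp
qed simp

text \<open>A bound uniform in \<open>K\<close>: the weight k comes from the linear drift \<epsilon>
  k \<open>P1\<close>, the power from the decay of \<open>W k\<close>.\<close>

lemma sum_arith_geometric_le:
  fixes x :: real
  assumes "0 \<le> x" "x < 1"
  shows "(\<Sum>k<K. real k * x ^ k) \<le> 1 / (1 - x)\<^sup>2"
proof -
  have s: "(\<lambda>k. real (Suc k) * x ^ k) sums (1 / (1 - x)\<^sup>2)"
    using geometric_deriv_sums[of x] assms by simp
  have "(\<Sum>k<K. real k * x ^ k) \<le> (\<Sum>k<K. real (Suc k) * x ^ k)"
    using assms by (intro sum_mono mult_right_mono) auto
  also have "\<dots> \<le> 1 / (1 - x)\<^sup>2"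
    using sum_le_suminf[OF sums_summable[OF s], of "{..<K}"] sums_unique[OF s] assms by simp
  finally show ?thesis .
qed

text \<open>Irreducibility and aperiodicity enter here only through \<open>decay\<close>. Fixing
  \<pi>, \<open>C\<close> and \<rho> as parameters keeps all later constants independent of
  \<epsilon>.\<close>

locale ergodic_matrix =
  fixes A :: "real ^ 's ^ 's::finite" and \<pi> :: "real ^ 's" and C \<rho> :: real
  assumes stochastic: "stochastic A"
    and prob_\<pi>: "prob_vector \<pi>"
    and stationary: "\<pi> v* A = \<pi>"
    and \<rho>: "0 < \<rho>" "\<rho> < 1"
    and decay: "\<And>v k. v \<bullet> 1 = 0 \<Longrightarrow> l1_norm (v v* matrix_power A k) \<le> C * \<rho> ^ k * l1_norm v"
    and C_pos: "C > 0"
begin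

section \<open>Deviation from equilibrium and the fundamental matrix\<close>

definition W :: "nat \<Rightarrow> real ^ 's ^ 's" where
  "W k = matrix_power A k - rank_one_rows \<pi>"

text \<open>Its inverse is the fundamental matrix of the chain.\<close>

definition M :: "real ^ 's ^ 's" where
  "M = mat 1 - A + rank_one_rows \<pi>"

lemma stationary_power: "\<pi> v* matrix_power A k = \<pi>"
  by (induction k) (simp_all add: matrix_power_Suc stationary flip: vector_matrix_mul_assoc)

lemma prob_vector_W:
  assumes "prob_vector v"
  shows "v v* W k = (v - \<pi>) v* matrix_power A k"
  using assms by (simp add: W_def vector_matrix_mult_diff_rdistrib vector_matrix_mult_diff_distrib
      stationary_power vector_rank_one_rows prob_vector_inner_1)

text \<open>Row x of \<open>W k\<close> is \<open>axis x 1 - \<pi>\<close> moved k steps. This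
  vector has mass 0 and norm at most 2, so \<open>decay\<close> applies.\<close>

lemma matrix_norm_W: "matrix_norm (W k) \<le> 2 * C * \<rho> ^ k"
proof (rule matrix_norm_le)
  fix x :: 's
  have e: "prob_vector (axis x 1 :: real ^ 's)"
    by (auto simp: prob_vector_def axis_def)
  have "W k $ x = axis x 1 v* W k"
    by (simp add: vec_eq_iff vector_matrix_mult_def axis_def if_distrib[of "\<lambda>z. z * _"] cong: if_cong)
  also have "\<dots> = (axis x 1 - \<pi>) v* matrix_power A k" by (rule prob_vector_W[OF e])
  also have "l1_norm \<dots> \<le> C * \<rho> ^ k * l1_norm (axis x 1 - \<pi>)"
    by (rule decay) (simp add: inner_diff_left prob_vector_inner_1[OF prob_\<pi>] prob_vector_inner_1[OF e])
  also have "\<dots> \<le> C * \<rho> ^ k * 2"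
    using l1_norm_diff[of "axis x 1" \<pi>] C_pos \<rho>
    by (intro mult_left_mono) (auto simp: prob_vector_l1_norm[OF prob_\<pi>] prob_vector_l1_norm[OF e])
  finally show "l1_norm (W k $ x) \<le> 2 * C * \<rho> ^ k" by (simp add: mult_ac)
qed

lemma l1_norm_W: "l1_norm (v v* W k) \<le> l1_norm v * (2 * C * \<rho> ^ k)"
  using l1_norm_vector_matrix mult_left_mono[OF matrix_norm_W l1_norm_nonneg] by (rule order_trans)

lemma rank_one_rows_absorb:
  "A ** rank_one_rows \<pi> = rank_one_rows \<pi>"
  "rank_one_rows \<pi> ** matrix_power A k = rank_one_rows \<pi>"
  "rank_one_rows \<pi> ** rank_one_rows \<pi> = rank_one_rows \<pi>"
  by (simp_all add: stochastic_mult_rank_one_rows[OF stochastic] rank_one_rows_mult stationary_power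
      vector_rank_one_rows prob_vector_inner_1[OF prob_\<pi>])

lemma M_mult_rank_one: "M ** rank_one_rows \<pi> = rank_one_rows \<pi>"
  by (simp add: M_def matrix_add_rdistrib matrix_diff_rdistrib rank_one_rows_absorb)

text \<open>The rank one part of \<open>M\<close> annihilates \<open>W k\<close>, and \<Pi> is
  unchanged by \<open>A\<close>. Thus \<open>M\<close> acts as a difference operator in k, which
  makes summation by parts possible.\<close>

lemma M_mult_W: "M ** W k = W k - W (Suc k)"
  by (simp add: M_def W_def matrix_add_rdistrib matrix_diff_rdistrib matrix_diff_ldistrib
      rank_one_rows_absorb matrix_power_Suc')

text \<open>Summation by parts twice. In the induction the new term is (m+1) (W(m+1) - 2 W(m+2) +
  W(m+3)), exactly the change of the right-hand side. Only \<open>W 1\<close> survives for large m;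
  the rest decays geometrically up to a factor m.\<close>

lemma M_sq_sum_W:
  "M ** (M ** (\<Sum>k<Suc m. real k *\<^sub>R W k)) = W 1 - (W (Suc m) + real m *\<^sub>R (W (Suc m) - W (Suc (Suc m))))"
proof (induction m)
  case 0
  show ?case by (simp add: vec_eq_iff matrix_matrix_mult_def)
next
  case (Suc m)
  have "M ** (M ** (\<Sum>k<Suc (Suc m). real k *\<^sub>R W k))
      = M ** (M ** (\<Sum>k<Suc m. real k *\<^sub>R W k)) + real (Suc m) *\<^sub>R (M ** (M ** W (Suc m)))"
    by (subst sum.lessThan_Suc) (simp only: matrix_add_ldistrib matrix_scalar_ac scalar_matrix_assoc[symmetric])
  then show ?case
    unfolding Suc by (simp add: M_mult_W matrix_diff_ldistrib scaleR_add_left scaleR_add_right scaleR_diff_right del: sum.lessThan_Suc)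
qed

text \<open>If x M = 0, multiplying by \<Pi> shows that x has mass 0; then x A = x, so x is fixed by
  all powers of \<open>A\<close> and must vanish by \<open>decay\<close>. The transpose appears
  because the kernel criterion concerns column vectors.\<close>

lemma invertible_M: "invertible M"
proof -
  have "x = 0" if x: "transpose M *v x = 0" for x
  proof -
    have "x v* M = 0" using x by simp
    then have "x v* (M ** rank_one_rows \<pi>) = 0" by (simp flip: vector_matrix_mul_assoc)
    then have x\<pi>: "x v* rank_one_rows \<pi> = 0" by (simp only: M_mult_rank_one)
    then have "(x \<bullet> 1) *\<^sub>R \<pi> = 0" by (simp add: vector_rank_one_rows)
    then have x1: "x \<bullet> 1 = 0"
      using prob_vector_inner_1[OF prob_\<pi>] by auto
    have xA: "x v* A = x"
      using \<open>x v* M = 0\<close> x\<pi>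
      by (simp add: M_def vector_matrix_mult_add_rdistrib vector_matrix_mult_diff_rdistrib)
    have fixed: "x v* matrix_power A k = x" for k
      by (induction k) (simp_all add: matrix_power_Suc xA flip: vector_matrix_mul_assoc)
    have "(\<lambda>k. C * \<rho> ^ k * l1_norm x) \<longlonglongrightarrow> C * 0 * l1_norm x"
      using \<rho> by (intro tendsto_intros) auto
    then have "l1_norm x \<le> 0"
      using decay[OF x1] by (intro LIMSEQ_le_const) (auto simp: fixed)
    then show ?thesis using l1_norm_nonneg[of x] l1_norm_eq_0_iff[of x] by simp
  qed
  then obtain B where "B ** transpose M = mat 1"
    using matrix_left_invertible_ker[of "transpose M"] by blast
  then show ?thesis
    using left_invertible_transpose[of M] matrix_left_right_inverse unfolding invertible_def by blast
qed

lemma M_inverse: "M ** matrix_inv M = mat 1" "matrix_inv M ** M = mat 1"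
proof -
  have "M ** matrix_inv M = mat 1 \<and> matrix_inv M ** M = mat 1"
    unfolding matrix_inv_def by (rule someI_ex) (use invertible_M in \<open>simp add: invertible_def\<close>)
  then show "M ** matrix_inv M = mat 1" "matrix_inv M ** M = mat 1" by auto
qed

lemma sum_W:
  fixes m
  defines "X \<equiv> W (Suc m) + real m *\<^sub>R (W (Suc m) - W (Suc (Suc m)))"
  shows "(\<Sum>k<Suc m. real k *\<^sub>R W k) = matrix_inv M ** (matrix_inv M ** (W 1 - X))"
proof -
  have "matrix_inv M ** (matrix_inv M ** (M ** (M ** Y))) = Y" for Y :: "real ^ 's ^ 's"
    using M_inverse(2) by (metis matrix_mul_assoc matrix_mul_lid)
  then show ?thesis unfolding X_def M_sq_sum_W[symmetric] by (simp only:)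
qed

section \<open>Expansion along an orbit of the perturbed chain\<close>

lemma l1_norm_orbit_minus_stationary:
  assumes y: "\<And>k. k < L \<Longrightarrow> y k = y (Suc k) v* Q k"
    and Q: "\<And>k. k < L \<Longrightarrow> stochastic (Q k)"
    and d: "\<And>k. k < L \<Longrightarrow> matrix_norm (Q k - A) \<le> d"
    and yL: "prob_vector (y L)" and i: "i \<le> L" and d0: "0 \<le> d"
  shows "prob_vector (y i)" "l1_norm (y i - \<pi>) \<le> real L * d + 2 * C * \<rho> ^ (L - i)"
proof -
  have prob: "prob_vector (y j)" if "j \<le> L" for j
    using that by (induction j rule: inc_induct) (use y Q yL in \<open>auto simp: prob_vector_mult\<close>)
  then show "prob_vector (y i)" using i by simp
  \<comment> \<open>Each replaced factor costs at most \<open>d\<close>, since the stochastic power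
    behind it does not increase the norm, and the initial law \<open>y L\<close> is forgotten at
    rate \<rho>. This crude bound suffices because it will only be used behind the extra factor
    \<epsilon> of the drift.\<close>
  have "y i = y L v* matrix_power A (L - i)
           + (\<Sum>k<L - i. (y (Suc (i + k)) v* (Q (i + k) - A)) v* matrix_power A k)"
    using product_telescope[of "L - i" "\<lambda>k. y (i + k)" "\<lambda>k. Q (i + k)" A] y i by simp
  also have "y L v* matrix_power A (L - i) = y L v* W (L - i) + \<pi>"
    using yL by (simp add: W_def vector_matrix_mult_diff_rdistrib vector_rank_one_rows prob_vector_inner_1)
  finally have "l1_norm (y i - \<pi>) = l1_norm (y L v* W (L - i)
      + (\<Sum>k<L - i. (y (Suc (i + k)) v* (Q (i + k) - A)) v* matrix_power A k))"
    by simp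
  also have "\<dots> \<le> 2 * C * \<rho> ^ (L - i) + (\<Sum>k<L - i. d)"
  proof (intro order_trans[OF l1_norm_add] add_mono order_trans[OF l1_norm_sum] sum_mono)
    show "l1_norm (y L v* W (L - i)) \<le> 2 * C * \<rho> ^ (L - i)"
      using l1_norm_W[of "y L" "L - i"] prob_vector_l1_norm[OF yL] by simp
    fix k assume k: "k \<in> {..<L - i}"
    have "l1_norm ((y (Suc (i + k)) v* (Q (i + k) - A)) v* matrix_power A k)
        \<le> l1_norm (y (Suc (i + k)) v* (Q (i + k) - A))"
      by (intro l1_norm_vector_stochastic stochastic_matrix_power stochastic)
    also have "\<dots> \<le> matrix_norm (Q (i + k) - A)"
      using l1_norm_vector_matrix[of "y (Suc (i + k))"] k
      by (simp add: prob_vector_l1_norm prob)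
    also have "\<dots> \<le> d" using k by (intro d) auto
    finally show "l1_norm ((y (Suc (i + k)) v* (Q (i + k) - A)) v* matrix_power A k) \<le> d" .
  qed
  also have "(\<Sum>k<L - i. d) \<le> real L * d" using d0 by (simp add: mult_right_mono)
  finally show "l1_norm (y i - \<pi>) \<le> real L * d + 2 * C * \<rho> ^ (L - i)" by simp
qed

text \<open>An exact identity that isolates the first-order correction. The four terms on the right
  are the memory of the initial law, the residuals \<open>R k\<close>, the error of replacing
  \<open>y (Suc k)\<close> by \<pi> in the drift, and the boundary terms of the summation by
  parts.\<close>

lemma perturbation_identity:
  fixes Q :: "nat \<Rightarrow> real ^ 's ^ 's" and P1 :: "real ^ 's ^ 's"
  defines "B \<equiv> matrix_inv M"
  assumes P1: "P1 *v 1 = 0"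
    and y: "\<And>k. k < Suc m \<Longrightarrow> y k = y (Suc k) v* Q k"
    and yL: "prob_vector (y (Suc m))"
    and R: "\<And>k. R k = Q k - (A - (\<epsilon> * real k) *\<^sub>R P1)"
  shows "y 0 - \<pi> + \<epsilon> *\<^sub>R (\<pi> v* (P1 ** (B ** B) ** A))
    = y (Suc m) v* W (Suc m)
      + (\<Sum>k<Suc m. (y (Suc k) v* R k) v* matrix_power A k)
      - \<epsilon> *\<^sub>R (\<Sum>k<Suc m. real k *\<^sub>R (((y (Suc k) - \<pi>) v* P1) v* W k))
      + \<epsilon> *\<^sub>R (\<pi> v* P1 v* B v* B v* (W (Suc m) + real m *\<^sub>R (W (Suc m) - W (Suc (Suc m)))))"
proof -
  \<comment> \<open>This is where \<open>P1 *v 1 = 0\<close> is used: behind \<open>P1\<close> the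
    powers of \<open>A\<close> may be replaced by the decaying \<open>W k\<close>.\<close>
  have P1\<Pi>: "v v* P1 v* rank_one_rows \<pi> = 0" for v
    by (simp add: vector_rank_one_rows dot_lmul_matrix P1)
  have P1W: "v v* P1 v* matrix_power A k = v v* P1 v* W k" for v k
    by (simp add: W_def vector_matrix_mult_diff_rdistrib P1\<Pi>)
  have B\<Pi>: "B ** rank_one_rows \<pi> = rank_one_rows \<pi>"
    using M_inverse(2) M_mult_rank_one unfolding B_def by (metis matrix_mul_assoc matrix_mul_lid)
  have B\<Pi>': "v v* B v* rank_one_rows \<pi> = v v* rank_one_rows \<pi>" for v
    by (simp add: B\<Pi> vector_matrix_mul_assoc)
  define X where "X = W (Suc m) + real m *\<^sub>R (W (Suc m) - W (Suc (Suc m)))"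
  \<comment> \<open>\<open>W 1\<close> is A - \<Pi>, and its \<Pi> part drops out because
    \<open>B\<close> fixes \<Pi> and \<open>P1\<close> annihilates it.\<close>
  have "\<pi> v* P1 v* B v* B v* W 1 = \<pi> v* P1 v* B v* B v* A"
    using matrix_power_Suc[of A 0]
    by (simp add: W_def vector_matrix_mult_diff_rdistrib B\<Pi>' P1\<Pi>)
  then have sumW: "(\<Sum>k<Suc m. real k *\<^sub>R (\<pi> v* P1 v* W k))
      = \<pi> v* P1 v* B v* B v* A - \<pi> v* P1 v* B v* B v* X"
    using arg_cong[OF sum_W[of m], of "\<lambda>Y. \<pi> v* P1 v* Y"]
    by (simp only: vector_matrix_mult_sum_right vector_scaleR_matrix_ac X_def[symmetric] B_def[symmetric]
        vector_matrix_mul_assoc[symmetric] vector_matrix_mult_diff_rdistrib)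
  have summand: "(y (Suc k) v* (Q k - A)) v* matrix_power A k
     = (y (Suc k) v* R k) v* matrix_power A k
       - \<epsilon> *\<^sub>R (real k *\<^sub>R (((y (Suc k) - \<pi>) v* P1) v* W k))
       - \<epsilon> *\<^sub>R (real k *\<^sub>R (\<pi> v* P1 v* W k))" for k
  proof -
    have "Q k - A = R k - (\<epsilon> * real k) *\<^sub>R P1" by (simp add: R)
    then have "(y (Suc k) v* (Q k - A)) v* matrix_power A k
      = (y (Suc k) v* R k) v* matrix_power A k - (\<epsilon> * real k) *\<^sub>R (y (Suc k) v* P1 v* W k)"
      by (simp add: vector_matrix_mult_diff_rdistrib vector_matrix_mult_diff_distrib
          vector_scaleR_matrix_ac scaleR_vector_matrix_assoc[symmetric] P1W)
    then show ?thesis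
      by (simp add: vector_matrix_mult_diff_distrib scaleR_diff_right)
  qed
  have "y 0 = y (Suc m) v* matrix_power A (Suc m)
           + (\<Sum>k<Suc m. (y (Suc k) v* (Q k - A)) v* matrix_power A k)"
    using y by (rule product_telescope)
  also have "y (Suc m) v* matrix_power A (Suc m) = y (Suc m) v* W (Suc m) + \<pi>"
    using yL by (simp add: W_def vector_matrix_mult_diff_rdistrib vector_rank_one_rows prob_vector_inner_1)
  finally show ?thesis
    unfolding summand sum_subtractf scaleR_sum_right[symmetric] sumW X_def[symmetric]
    by (simp add: vector_matrix_mul_assoc[symmetric] matrix_mul_assoc scaleR_diff_right
       del: sum.lessThan_Suc)
qed

text \<open>Estimates the four terms of \<open>perturbation_identity\<close>. The constant is fixed
  before \<epsilon>, m, Q and y, so it serves the whole family. The condition on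
  \<open>\<rho> ^ m\<close> makes boundary and memory terms negligible; \<epsilon> m at most 1 lets
  quadratic residuals be absorbed into linear ones.\<close>

lemma perturbation_bound:
  fixes P1 :: "real ^ 's ^ 's" and c :: real
  defines "B \<equiv> matrix_inv M"
  assumes P1: "P1 *v 1 = 0" and c: "c \<ge> 0"
  obtains K where
    "\<And>\<epsilon> m Q y. 0 < \<epsilon> \<Longrightarrow> m \<ge> 1 \<Longrightarrow> \<epsilon> * real m \<le> 1 \<Longrightarrow> \<rho> ^ m \<le> \<epsilon>\<^sup>2 \<Longrightarrow>
      (\<And>k. k < Suc m \<Longrightarrow> stochastic (Q k)) \<Longrightarrow> prob_vector (y (Suc m)) \<Longrightarrow>
      (\<And>k. k < Suc m \<Longrightarrow> y k = y (Suc k) v* Q k) \<Longrightarrow>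
      (\<And>k. k < Suc m \<Longrightarrow> matrix_norm (Q k - (A - (\<epsilon> * real k) *\<^sub>R P1)) \<le> c * (\<epsilon>\<^sup>2 * (real m)\<^sup>2)) \<Longrightarrow>
      l1_norm (y 0 - \<pi> + \<epsilon> *\<^sub>R (\<pi> v* (P1 ** (B ** B) ** A))) \<le> K * (\<epsilon>\<^sup>2 * real m ^ 3)"
proof -
  define p where "p = matrix_norm P1"
  define D where "D = 2 * C"
  define S where "S = 1 / (1 - \<rho>)\<^sup>2"
  define u where "u = \<pi> v* P1 v* B v* B"
  have nn: "0 \<le> p" "0 \<le> D" "0 \<le> S" "0 \<le> l1_norm u"
    using C_pos by (auto simp: p_def D_def S_def)
  define K where "K = D + 2 * c + (p * D * (2 * (p + c) * S + 2 * D)) + 3 * l1_norm u * D"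
  have "l1_norm (y 0 - \<pi> + \<epsilon> *\<^sub>R (\<pi> v* (P1 ** (B ** B) ** A))) \<le> K * (\<epsilon>\<^sup>2 * real m ^ 3)"
    if \<epsilon>: "0 < \<epsilon>" and m: "m \<ge> 1" and \<epsilon>m: "\<epsilon> * real m \<le> 1" and \<rho>m: "\<rho> ^ m \<le> \<epsilon>\<^sup>2"
      and Q: "\<And>k. k < Suc m \<Longrightarrow> stochastic (Q k)" and yL: "prob_vector (y (Suc m))"
      and y: "\<And>k. k < Suc m \<Longrightarrow> y k = y (Suc k) v* Q k"
      and R: "\<And>k. k < Suc m \<Longrightarrow>
        matrix_norm (Q k - (A - (\<epsilon> * real k) *\<^sub>R P1)) \<le> c * (\<epsilon>\<^sup>2 * (real m)\<^sup>2)"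
    for \<epsilon> m Q y
  proof -
    let ?m = "real m" and ?E = "\<epsilon>\<^sup>2 * real m ^ 3"
    have m1: "?m \<ge> 1" using m by simp
    have \<epsilon>1: "\<epsilon> \<le> 1" using \<epsilon>m mult_left_mono[OF m1, of \<epsilon>] \<epsilon> by linarith
    have E2: "\<epsilon>\<^sup>2 * ?m\<^sup>2 \<le> ?E"
      using m1 by (intro mult_left_mono power_increasing) auto
    have E0: "\<epsilon>\<^sup>2 \<le> ?E"
      using m1 mult_left_mono[of 1 "?m ^ 3" "\<epsilon>\<^sup>2"] by simp
    have E1: "\<epsilon>\<^sup>2 * ?m \<le> ?E"
      using m1 power_increasing[of 1 3 ?m] by (intro mult_left_mono) auto
    have \<rho>le: "\<rho> ^ (m + j) \<le> \<epsilon>\<^sup>2" for j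
      using \<rho> \<rho>m power_decreasing[of m "m + j" \<rho>] by linarith
    \<comment> \<open>The drift contributes \<epsilon> m p, and the residual c \<epsilon>^2 m^2 is
      at most c \<epsilon> m.\<close>
    define d where "d = \<epsilon> * ?m * (p + c)"
    have d0: "0 \<le> d" using \<epsilon> nn c by (simp add: d_def)
    have d: "matrix_norm (Q k - A) \<le> d" if "k < Suc m" for k
    proof (rule matrix_norm_le)
      fix x
      let ?R = "Q k - (A - (\<epsilon> * real k) *\<^sub>R P1)"
      have "(Q k - A) $ x = ?R $ x - (\<epsilon> * real k) *\<^sub>R (P1 $ x)" by simp
      then have "l1_norm ((Q k - A) $ x) \<le> l1_norm (?R $ x) + (\<epsilon> * real k) * l1_norm (P1 $ x)"
        using l1_norm_diff[of "?R $ x" "(\<epsilon> * real k) *\<^sub>R (P1 $ x)"] \<epsilon> by (simp add: l1_norm_scaleR)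
      also have "\<dots> \<le> c * (\<epsilon>\<^sup>2 * ?m\<^sup>2) + (\<epsilon> * ?m) * p"
        using that \<epsilon> unfolding p_def
        by (intro add_mono mult_mono order_trans[OF l1_norm_row_le R] l1_norm_row_le) auto
      also have "\<dots> \<le> c * (\<epsilon> * ?m) + (\<epsilon> * ?m) * p"
      proof (intro add_right_mono mult_left_mono c)
        show "\<epsilon>\<^sup>2 * ?m\<^sup>2 \<le> \<epsilon> * ?m"
          using \<epsilon> \<epsilon>m mult_left_mono[of "\<epsilon> * ?m" 1 "\<epsilon> * ?m"]
          by (simp add: power2_eq_square mult_ac)
      qed
      also have "\<dots> = d" by (simp add: d_def algebra_simps)
      finally show "l1_norm ((Q k - A) $ x) \<le> d" .
    qed
    note orbit = l1_norm_orbit_minus_stationary[of "Suc m" y Q d, OF y Q d yL _ d0]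
    have Dl1: "l1_norm (v v* W k) \<le> l1_norm v * (D * \<rho> ^ k)" for v k
      using l1_norm_W[of v k] by (simp add: D_def)
    have T1: "l1_norm (y (Suc m) v* W (Suc m)) \<le> D * ?E"
    proof -
      have "l1_norm (y (Suc m) v* W (Suc m)) \<le> D * \<rho> ^ (m + 1)"
        using Dl1[of "y (Suc m)" "Suc m"] prob_vector_l1_norm[OF yL] by simp
      also have "\<dots> \<le> D * ?E"
        using \<rho>le[of 1] E0 nn by (intro mult_left_mono) auto
      finally show ?thesis .
    qed
    \<comment> \<open>Here m + 1 residuals of size \<epsilon>^2 m^2 add up. Of the four estimates
      this is the only one that needs the full order \<epsilon>^2 m^3.\<close>
    have T2: "l1_norm (\<Sum>k<Suc m. (y (Suc k) v* (Q k - (A - (\<epsilon> * real k) *\<^sub>R P1))) v* matrix_power A k)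
        \<le> 2 * c * ?E"
    proof -
      have "l1_norm (\<Sum>k<Suc m. (y (Suc k) v* (Q k - (A - (\<epsilon> * real k) *\<^sub>R P1))) v* matrix_power A k)
          \<le> (\<Sum>k<Suc m. c * (\<epsilon>\<^sup>2 * ?m\<^sup>2))"
      proof (intro order_trans[OF l1_norm_sum] sum_mono)
        fix k assume k: "k \<in> {..<Suc m}"
        let ?R = "Q k - (A - (\<epsilon> * real k) *\<^sub>R P1)"
        have "l1_norm ((y (Suc k) v* ?R) v* matrix_power A k) \<le> l1_norm (y (Suc k) v* ?R)"
          by (intro l1_norm_vector_stochastic stochastic_matrix_power stochastic)
        also have "\<dots> \<le> matrix_norm ?R"
          using l1_norm_vector_matrix[of "y (Suc k)" ?R] prob_vector_l1_norm[OF orbit(1)[of "Suc k"]] k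
          by simp
        also have "\<dots> \<le> c * (\<epsilon>\<^sup>2 * ?m\<^sup>2)" using k by (intro R) auto
        finally show "l1_norm ((y (Suc k) v* ?R) v* matrix_power A k) \<le> c * (\<epsilon>\<^sup>2 * ?m\<^sup>2)" .
      qed
      also have "\<dots> = (?m + 1) * (c * (\<epsilon>\<^sup>2 * ?m\<^sup>2))" by (simp add: algebra_simps)
      also have "\<dots> \<le> (2 * ?m) * (c * (\<epsilon>\<^sup>2 * ?m\<^sup>2))"
        using m1 c by (intro mult_right_mono) auto
      finally show ?thesis by (simp add: power2_eq_square power3_eq_cube mult_ac)
    qed
    have T3: "l1_norm (\<epsilon> *\<^sub>R (\<Sum>k<Suc m. real k *\<^sub>R (((y (Suc k) - \<pi>) v* P1) v* W k)))
        \<le> (p * D * (2 * (p + c) * S + 2 * D)) * ?E"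
    proof -
      have "l1_norm (\<Sum>k<Suc m. real k *\<^sub>R (((y (Suc k) - \<pi>) v* P1) v* W k))
        \<le> (\<Sum>k<Suc m. real k * (((2 * ?m * d + D * \<rho> ^ (m - k)) * p) * (D * \<rho> ^ k)))"
      proof (intro order_trans[OF l1_norm_sum] sum_mono)
        fix k assume k: "k \<in> {..<Suc m}"
        have "l1_norm (y (Suc k) - \<pi>) \<le> real (Suc m) * d + D * \<rho> ^ (m - k)"
          using orbit(2)[of "Suc k"] k by (simp add: D_def)
        also have "\<dots> \<le> 2 * ?m * d + D * \<rho> ^ (m - k)"
          using m1 d0 by (intro add_right_mono mult_right_mono) auto
        finally have "l1_norm ((y (Suc k) - \<pi>) v* P1) \<le> (2 * ?m * d + D * \<rho> ^ (m - k)) * p"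
          unfolding p_def by (intro order_trans[OF l1_norm_vector_matrix] mult_right_mono) auto
        then have "l1_norm (((y (Suc k) - \<pi>) v* P1) v* W k)
            \<le> ((2 * ?m * d + D * \<rho> ^ (m - k)) * p) * (D * \<rho> ^ k)"
          using nn \<rho> by (intro order_trans[OF Dl1] mult_right_mono) auto
        then show "l1_norm (real k *\<^sub>R (((y (Suc k) - \<pi>) v* P1) v* W k))
            \<le> real k * (((2 * ?m * d + D * \<rho> ^ (m - k)) * p) * (D * \<rho> ^ k))"
          by (simp add: l1_norm_scaleR mult_left_mono)
      qed
      \<comment> \<open>The two decays are complementary: forgetting the initial law gives
        \<open>\<rho> ^ (m - k)\<close> and \<open>W k\<close> gives \<open>\<rho> ^ k\<close>, so
        their product does not depend on k.\<close>
      also have "\<dots> = (\<Sum>k<Suc m. p * D * (2 * ?m * d * (real k * \<rho> ^ k) + D * \<rho> ^ m * real k))"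
      proof (intro sum.cong refl)
        fix k assume "k \<in> {..<Suc m}"
        then have "\<rho> ^ (m - k) * \<rho> ^ k = \<rho> ^ m" by (simp flip: power_add)
        moreover have "real k * (((2 * ?m * d + D * \<rho> ^ (m - k)) * p) * (D * \<rho> ^ k))
          = p * D * (2 * ?m * d * (real k * \<rho> ^ k) + D * (\<rho> ^ (m - k) * \<rho> ^ k) * real k)"
          by (simp add: distrib_left distrib_right mult_ac)
        ultimately show "real k * (((2 * ?m * d + D * \<rho> ^ (m - k)) * p) * (D * \<rho> ^ k))
          = p * D * (2 * ?m * d * (real k * \<rho> ^ k) + D * \<rho> ^ m * real k)"
          by (simp only:)
      qed
      also have "\<dots> = p * D * (2 * ?m * d * (\<Sum>k<Suc m. real k * \<rho> ^ k) + D * \<rho> ^ m * (\<Sum>k<Suc m. real k))"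
        by (simp only: sum_distrib_left[symmetric] sum.distrib)
      also have "\<dots> \<le> p * D * (2 * ?m * d * S + D * \<epsilon>\<^sup>2 * (2 * ?m\<^sup>2))"
      proof (rule mult_left_mono[OF add_mono])
        have "(\<Sum>k<Suc m. real k * \<rho> ^ k) \<le> S"
          unfolding S_def using \<rho> by (intro sum_arith_geometric_le) auto
        then show "2 * ?m * d * (\<Sum>k<Suc m. real k * \<rho> ^ k) \<le> 2 * ?m * d * S"
          using d0 by (intro mult_left_mono) auto
        have "(\<Sum>k<Suc m. real k) \<le> (\<Sum>k<Suc m. ?m)" by (intro sum_mono) auto
        also have "\<dots> \<le> (2 * ?m) * ?m" using m1 by (simp add: algebra_simps)
        finally have "(\<Sum>k<Suc m. real k) \<le> 2 * ?m\<^sup>2" by (simp add: power2_eq_square)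
        moreover have "D * \<rho> ^ m \<le> D * \<epsilon>\<^sup>2" using nn \<rho>m by (intro mult_left_mono) auto
        moreover have "0 \<le> (\<Sum>k<Suc m. real k)" by (intro sum_nonneg) auto
        ultimately show "D * \<rho> ^ m * (\<Sum>k<Suc m. real k) \<le> D * \<epsilon>\<^sup>2 * (2 * ?m\<^sup>2)"
          using nn by (intro mult_mono[of "D * \<rho> ^ m"]) auto
        show "0 \<le> p * D" using nn by simp
      qed
      finally have "l1_norm (\<epsilon> *\<^sub>R (\<Sum>k<Suc m. real k *\<^sub>R (((y (Suc k) - \<pi>) v* P1) v* W k)))
          \<le> \<epsilon> * (p * D * (2 * ?m * d * S + D * \<epsilon>\<^sup>2 * (2 * ?m\<^sup>2)))"
        using \<epsilon> by (simp add: l1_norm_scaleR mult_left_mono del: sum.lessThan_Suc)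
      also have "\<dots> = p * D * (2 * (p + c) * S * (\<epsilon>\<^sup>2 * ?m\<^sup>2) + 2 * D * (\<epsilon> * (\<epsilon>\<^sup>2 * ?m\<^sup>2)))"
        by (simp add: d_def power2_eq_square distrib_left mult_ac)
      also have "\<dots> \<le> p * D * (2 * (p + c) * S * ?E + 2 * D * (1 * ?E))"
        using nn c \<epsilon> \<epsilon>1 E2 by (intro mult_left_mono add_mono mult_mono) auto
      finally show ?thesis by (simp add: algebra_simps)
    qed
    have T4: "l1_norm (\<epsilon> *\<^sub>R (u v* (W (Suc m) + ?m *\<^sub>R (W (Suc m) - W (Suc (Suc m))))))
        \<le> 3 * l1_norm u * D * ?E"
    proof -
      have Wle: "l1_norm (u v* W (m + j)) \<le> l1_norm u * D * \<epsilon>\<^sup>2" for j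
        using Dl1[of u "m + j"] mult_left_mono[OF \<rho>le[of j], of "l1_norm u * D"] nn
        by (simp add: mult.assoc)
      have "u v* (W (Suc m) + ?m *\<^sub>R (W (Suc m) - W (Suc (Suc m))))
          = u v* W (m + 1) + ?m *\<^sub>R (u v* W (m + 1) - u v* W (m + 2))"
        by (simp add: vector_matrix_mult_add_rdistrib vector_scaleR_matrix_ac vector_matrix_mult_diff_rdistrib)
      also have "l1_norm \<dots> \<le> l1_norm (u v* W (m + 1))
          + ?m * (l1_norm (u v* W (m + 1)) + l1_norm (u v* W (m + 2)))"
        using l1_norm_diff[of "u v* W (m + 1)" "u v* W (m + 2)"]
        by (intro order_trans[OF l1_norm_add] add_left_mono) (simp add: l1_norm_scaleR mult_left_mono)
      also have "\<dots> \<le> l1_norm u * D * \<epsilon>\<^sup>2 + ?m * (l1_norm u * D * \<epsilon>\<^sup>2 + l1_norm u * D * \<epsilon>\<^sup>2)"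
        by (intro add_mono mult_left_mono Wle) auto
      also have "\<dots> = l1_norm u * D * (\<epsilon>\<^sup>2 + 2 * (\<epsilon>\<^sup>2 * ?m))" by (simp add: algebra_simps)
      also have "\<dots> \<le> l1_norm u * D * (?E + 2 * ?E)"
        by (intro mult_left_mono mult_nonneg_nonneg nn) (use E0 E1 in linarith)
      finally have "l1_norm (u v* (W (Suc m) + ?m *\<^sub>R (W (Suc m) - W (Suc (Suc m)))))
          \<le> 3 * l1_norm u * D * ?E" by simp
      then have "\<epsilon> * l1_norm (u v* (W (Suc m) + ?m *\<^sub>R (W (Suc m) - W (Suc (Suc m)))))
          \<le> 1 * (3 * l1_norm u * D * ?E)"
        using \<epsilon> \<epsilon>1 by (intro mult_mono) auto
      then show ?thesis using \<epsilon> by (simp add: l1_norm_scaleR)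
    qed
    have "y 0 - \<pi> + \<epsilon> *\<^sub>R (\<pi> v* (P1 ** (B ** B) ** A))
      = y (Suc m) v* W (Suc m)
        + (\<Sum>k<Suc m. (y (Suc k) v* (Q k - (A - (\<epsilon> * real k) *\<^sub>R P1))) v* matrix_power A k)
        - \<epsilon> *\<^sub>R (\<Sum>k<Suc m. real k *\<^sub>R (((y (Suc k) - \<pi>) v* P1) v* W k))
        + \<epsilon> *\<^sub>R (u v* (W (Suc m) + ?m *\<^sub>R (W (Suc m) - W (Suc (Suc m)))))"
      unfolding u_def B_def using P1 y yL refl by (rule perturbation_identity)
    then have "l1_norm (y 0 - \<pi> + \<epsilon> *\<^sub>R (\<pi> v* (P1 ** (B ** B) ** A)))
        \<le> D * ?E + 2 * c * ?E + (p * D * (2 * (p + c) * S + 2 * D)) * ?E + 3 * l1_norm u * D * ?E"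
      by (simp only:) (intro order_trans[OF l1_norm_add] order_trans[OF l1_norm_diff] add_mono T1 T2 T3 T4)
    also have "\<dots> = K * ?E" by (simp add: K_def algebra_simps)
    finally show ?thesis .
  qed
  then show ?thesis by (rule that)
qed

end

subsection \<open>The expansion\<close>

lemma matrix_prod_prob_vector:
  assumes "prob_vector v" "\<And>i. 1 \<le> i \<Longrightarrow> i \<le> n \<Longrightarrow> stochastic (P i)"
  shows "prob_vector (v v* matrix_prod P n)"
  using assms(2)
  by (induction n) (auto simp: assms(1) prob_vector_mult simp flip: vector_matrix_mul_assoc)

theorem theorem5:
  fixes \<mu> r :: "real ^ 's::finite"
    and P :: "nat \<Rightarrow> real \<Rightarrow> real ^ 's ^ 's"
    and n m :: "real \<Rightarrow> nat"
    and a :: "real \<Rightarrow> real"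
    and Pt P1 :: "real ^ 's ^ 's"
  assumes "prob_vector \<mu>"
    and "\<And>i \<epsilon>. i \<ge> 1 \<Longrightarrow> \<epsilon> > 0 \<Longrightarrow> stochastic (P i \<epsilon>)"
    and "\<And>\<epsilon>. \<epsilon> > 0 \<Longrightarrow> n \<epsilon> \<ge> 1"
    and "filterlim (\<lambda>\<epsilon>. real (n \<epsilon>) / ln (1 / \<epsilon>)) at_top (at_right 0)"
    and "filterlim a at_top (at_right 0)"
    and "\<And>\<epsilon>. \<epsilon> > 0 \<Longrightarrow> m \<epsilon> = nat \<lfloor>min (real (n \<epsilon>) / 2) (a \<epsilon> * ln (1 / \<epsilon>))\<rfloor>"
    and "stochastic Pt" and "irreducible_matrix Pt" and "aperiodic_matrix Pt"
    and "(\<lambda>\<epsilon>. SUP k\<in>{0..m \<epsilon>}. matrix_norm (P (n \<epsilon> - k) \<epsilon> - (Pt - (\<epsilon> * real k) *\<^sub>R P1)))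
           \<in> O[at_right 0](\<lambda>\<epsilon>. \<epsilon>\<^sup>2 * (real (m \<epsilon>))\<^sup>2)"
  shows "(\<lambda>\<epsilon>. (\<mu> v* matrix_prod (\<lambda>k. P k \<epsilon>) (n \<epsilon>)) \<bullet> r
           - (let \<pi> = stationary_distribution Pt;
                  B = matrix_inv (mat 1 - Pt + rank_one_rows \<pi>)
              in \<pi> \<bullet> r - \<epsilon> * ((\<pi> v* (P1 ** (B ** B) ** Pt)) \<bullet> r)))
         \<in> O[at_right 0](\<lambda>\<epsilon>. \<epsilon>\<^sup>2 * real (m \<epsilon>) ^ 3)"
proof -
  note \<mu> = assms(1) and P = assms(2) and n = assms(3) and nlim = assms(4) and alim = assms(5)
    and m = assms(6)
  obtain C \<rho> where C: "C > 0" "0 < \<rho>" "\<rho> < 1"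
    "\<And>v k. v \<bullet> 1 = 0 \<Longrightarrow> l1_norm (v v* matrix_power Pt k) \<le> C * \<rho> ^ k * l1_norm v"
    using l1_norm_geometric_decay[OF assms(7-9)] by blast
  define \<pi> where "\<pi> = stationary_distribution Pt"
  interpret ergodic_matrix Pt \<pi> C \<rho>
    using stationary_distribution_props[OF assms(7-9)] C assms(7)
    by unfold_locales (auto simp: \<pi>_def)
  define B where "B = matrix_inv M"
  define w where "w = \<pi> v* (P1 ** (B ** B) ** Pt)"
  \<comment> \<open>The error as a row vector; \<open>r\<close> enters only at the end, through the
    pairing.\<close>
  define f where "f \<epsilon> = \<mu> v* matrix_prod (\<lambda>k. P k \<epsilon>) (n \<epsilon>) - \<pi> + \<epsilon> *\<^sub>R w" for \<epsilon>
  obtain c where c: "c > 0" and c_ev: "eventually (\<lambda>\<epsilon>. norm (SUP k\<in>{0..m \<epsilon>}. matrix_norm (P (n \<epsilon> - k) \<epsilon>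
      - (Pt - (\<epsilon> * real k) *\<^sub>R P1))) \<le> c * norm (\<epsilon>\<^sup>2 * (real (m \<epsilon>))\<^sup>2)) (at_right 0)"
    using assms(10) by (elim landau_o.bigE)
  have pos: "eventually (\<lambda>\<epsilon>::real. 0 < \<epsilon> \<and> \<epsilon> < 1) (at_right 0)"
    unfolding eventually_at_right_field by (intro exI[of _ 1]) auto
  \<comment> \<open>Chosen so that \<rho> to the power L ln(1/\<epsilon>) equals
    \<epsilon>^2.\<close>
  define L where "L = 2 / ln (1 / \<rho>)"
  have ln\<rho>: "ln (1 / \<rho>) > 0" using C by simp
  have m_large: "eventually (\<lambda>\<epsilon>. 1 \<le> m \<epsilon> \<and> \<rho> ^ m \<epsilon> \<le> \<epsilon>\<^sup>2) (at_right 0)"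
  proof -
    have lnlim: "filterlim (\<lambda>\<epsilon>::real. ln (1 / \<epsilon>)) at_top (at_right 0)"
      using filterlim_compose[OF ln_at_top filterlim_inverse_at_top_right] by (simp add: inverse_eq_divide)
    \<comment> \<open>The surplus 1 over \<open>L\<close> pays for the floor in \<open>m\<close>,
      since ln(1/\<epsilon>) is eventually at least 1.\<close>
    have "eventually (\<lambda>\<epsilon>. 2 * (L + 1) \<le> real (n \<epsilon>) / ln (1 / \<epsilon>)) (at_right 0)"
      "eventually (\<lambda>\<epsilon>. L + 1 \<le> a \<epsilon>) (at_right 0)"
      "eventually (\<lambda>\<epsilon>::real. 1 \<le> ln (1 / \<epsilon>)) (at_right 0)"
      using nlim alim lnlim unfolding filterlim_at_top by blast+
    then show ?thesis using pos
    proof eventually_elim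
      case (elim \<epsilon>)
      let ?l = "ln (1 / \<epsilon>)"
      have L0: "L > 0" using ln\<rho> by (simp add: L_def)
      have "(L + 1) * ?l \<le> min (real (n \<epsilon>) / 2) (a \<epsilon> * ?l)"
      proof (rule min.boundedI)
        have "2 * (L + 1) * ?l \<le> real (n \<epsilon>)" using elim by (simp add: le_divide_eq)
        then show "(L + 1) * ?l \<le> real (n \<epsilon>) / 2" by linarith
        show "(L + 1) * ?l \<le> a \<epsilon> * ?l" using elim by (intro mult_right_mono) auto
      qed
      moreover have "L * ?l + 1 \<le> (L + 1) * ?l" using elim by (simp add: algebra_simps)
      ultimately have le: "L * ?l \<le> real (m \<epsilon>)" and "1 \<le> m \<epsilon>"
        using L0 elim m[of \<epsilon>] mult_pos_pos[of L ?l] by linarith+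
      have "\<rho> ^ m \<epsilon> = exp (- (real (m \<epsilon>) * ln (1 / \<rho>)))"
        using C by (simp add: ln_div powr_def flip: powr_realpow)
      also have "\<dots> \<le> exp (- ((L * ?l) * ln (1 / \<rho>)))"
        using le ln\<rho> by simp
      also have "(L * ?l) * ln (1 / \<rho>) = 2 * ?l" using ln\<rho> by (simp add: L_def)
      also have "exp (- (2 * ?l)) = \<epsilon>\<^sup>2"
        using elim by (simp add: ln_div exp_double)
      finally show ?case using \<open>1 \<le> m \<epsilon>\<close> by simp
    qed
  qed
  have approx: "eventually (\<lambda>\<epsilon>. \<forall>k\<le>m \<epsilon>. matrix_norm (P (n \<epsilon> - k) \<epsilon> - (Pt - (\<epsilon> * real k) *\<^sub>R P1))
      \<le> c * (\<epsilon>\<^sup>2 * (real (m \<epsilon>))\<^sup>2)) (at_right 0)"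
    using c_ev
  proof eventually_elim
    case (elim \<epsilon>)
    show ?case
    proof (intro allI impI)
      fix k assume "k \<le> m \<epsilon>"
      then have "matrix_norm (P (n \<epsilon> - k) \<epsilon> - (Pt - (\<epsilon> * real k) *\<^sub>R P1))
          \<le> (SUP k\<in>{0..m \<epsilon>}. matrix_norm (P (n \<epsilon> - k) \<epsilon> - (Pt - (\<epsilon> * real k) *\<^sub>R P1)))"
        by (intro cSUP_upper) auto
      then show "matrix_norm (P (n \<epsilon> - k) \<epsilon> - (Pt - (\<epsilon> * real k) *\<^sub>R P1)) \<le> c * (\<epsilon>\<^sup>2 * (real (m \<epsilon>))\<^sup>2)"
        using elim by simp
    qed
  qed
  \<comment> \<open>Hence all indices \<open>n \<epsilon> - k\<close> with k up to
    \<open>m \<epsilon>\<close> are at least 1, where the matrices are stochastic and the truncated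
    subtraction is exact.\<close>
  have m_less_n: "m \<epsilon> < n \<epsilon>" if "0 < \<epsilon>" for \<epsilon>
    using n[OF that] m[OF that] by linarith
  (* Unless \<epsilon> m tends to 0, the claimed error \<epsilon>^2 m^3 does not tend to 0 and boundedness suffices. *)
  have coarse: "l1_norm (f \<epsilon>) \<le> (2 + l1_norm w) / \<eta>\<^sup>2 * (\<epsilon>\<^sup>2 * real (m \<epsilon>) ^ 3)"
    if "0 < \<epsilon>" "\<epsilon> < 1" "1 \<le> m \<epsilon>" "0 < \<eta>" "\<eta> \<le> \<epsilon> * real (m \<epsilon>)" for \<epsilon> \<eta>
  proof -
    have "l1_norm (f \<epsilon>) \<le> 1 + 1 + 1 * l1_norm w"
    proof -
      have "l1_norm (\<mu> v* matrix_prod (\<lambda>k. P k \<epsilon>) (n \<epsilon>)) = 1"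
        using P that by (intro prob_vector_l1_norm matrix_prod_prob_vector \<mu>) auto
      then have "l1_norm (\<mu> v* matrix_prod (\<lambda>k. P k \<epsilon>) (n \<epsilon>) - \<pi>) \<le> 1 + 1"
        using l1_norm_diff prob_vector_l1_norm[OF prob_\<pi>] by metis
      moreover have "l1_norm (\<epsilon> *\<^sub>R w) \<le> 1 * l1_norm w"
        unfolding l1_norm_scaleR using that by (intro mult_right_mono) auto
      ultimately show ?thesis
        unfolding f_def by (intro order_trans[OF l1_norm_add] add_mono)
    qed
    also have "\<dots> = (2 + l1_norm w) / \<eta>\<^sup>2 * \<eta>\<^sup>2" using that by simp
    also have "\<dots> \<le> (2 + l1_norm w) / \<eta>\<^sup>2 * (\<epsilon> * real (m \<epsilon>))\<^sup>2"
      using that by (intro mult_left_mono power_mono divide_nonneg_nonneg add_nonneg_nonneg) auto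
    also have "\<dots> = (2 + l1_norm w) / \<eta>\<^sup>2 * (\<epsilon>\<^sup>2 * (real (m \<epsilon>))\<^sup>2)" by (simp add: power_mult_distrib)
    also have "\<dots> \<le> (2 + l1_norm w) / \<eta>\<^sup>2 * (\<epsilon>\<^sup>2 * real (m \<epsilon>) ^ 3)"
      using that by (intro mult_left_mono power_increasing divide_nonneg_nonneg add_nonneg_nonneg) auto
    finally show ?thesis .
  qed
  obtain K where "eventually (\<lambda>\<epsilon>. l1_norm (f \<epsilon>) \<le> K * (\<epsilon>\<^sup>2 * real (m \<epsilon>) ^ 3)) (at_right 0)"
  proof (cases "P1 *v 1 = 0")
    case True
    show ?thesis
    proof (rule perturbation_bound[OF True less_imp_le[OF c], folded B_def, folded w_def])
      fix K :: real
      assume K: "\<And>\<epsilon> m Q y. 0 < \<epsilon> \<Longrightarrow> m \<ge> 1 \<Longrightarrow> \<epsilon> * real m \<le> 1 \<Longrightarrow> \<rho> ^ m \<le> \<epsilon>\<^sup>2 \<Longrightarrow>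
        (\<And>k. k < Suc m \<Longrightarrow> stochastic (Q k)) \<Longrightarrow> prob_vector (y (Suc m)) \<Longrightarrow>
        (\<And>k. k < Suc m \<Longrightarrow> y k = y (Suc k) v* Q k) \<Longrightarrow>
        (\<And>k. k < Suc m \<Longrightarrow> matrix_norm (Q k - (Pt - (\<epsilon> * real k) *\<^sub>R P1)) \<le> c * (\<epsilon>\<^sup>2 * (real m)\<^sup>2)) \<Longrightarrow>
        l1_norm (y 0 - \<pi> + \<epsilon> *\<^sub>R w) \<le> K * (\<epsilon>\<^sup>2 * real m ^ 3)"
      \<comment> \<open>The maximum covers both regimes: \<open>K\<close> when \<epsilon> m is at
        most 1, and otherwise the constant of \<open>coarse\<close> with \<eta> = 1. The regime may
        change with \<epsilon>.\<close>
      have "eventually (\<lambda>\<epsilon>. l1_norm (f \<epsilon>) \<le> max K (2 + l1_norm w) * (\<epsilon>\<^sup>2 * real (m \<epsilon>) ^ 3)) (at_right 0)"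
        using approx m_large pos
      proof eventually_elim
        case (elim \<epsilon>)
        have "l1_norm (f \<epsilon>) \<le> K * (\<epsilon>\<^sup>2 * real (m \<epsilon>) ^ 3) \<or>
            l1_norm (f \<epsilon>) \<le> (2 + l1_norm w) * (\<epsilon>\<^sup>2 * real (m \<epsilon>) ^ 3)"
        proof (cases "\<epsilon> * real (m \<epsilon>) \<le> 1")
          case le: True
          have "n \<epsilon> - k = Suc (n \<epsilon> - Suc k)" if "k < Suc (m \<epsilon>)" for k
            using that m_less_n[of \<epsilon>] elim by simp
          then have orbit: "\<mu> v* matrix_prod (\<lambda>k. P k \<epsilon>) (n \<epsilon> - k)
              = (\<mu> v* matrix_prod (\<lambda>k. P k \<epsilon>) (n \<epsilon> - Suc k)) v* P (n \<epsilon> - k) \<epsilon>"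
            if "k < Suc (m \<epsilon>)" for k
            using that by (simp add: vector_matrix_mul_assoc)
          have "l1_norm (\<mu> v* matrix_prod (\<lambda>k. P k \<epsilon>) (n \<epsilon> - 0) - \<pi> + \<epsilon> *\<^sub>R w)
              \<le> K * (\<epsilon>\<^sup>2 * real (m \<epsilon>) ^ 3)"
          proof (rule K[where Q = "\<lambda>k. P (n \<epsilon> - k) \<epsilon>" and y = "\<lambda>k. \<mu> v* matrix_prod (\<lambda>k. P k \<epsilon>) (n \<epsilon> - k)"])
            show "prob_vector (\<mu> v* matrix_prod (\<lambda>k. P k \<epsilon>) (n \<epsilon> - Suc (m \<epsilon>)))"
              using P elim by (intro matrix_prod_prob_vector \<mu>) auto
            fix k assume k: "k < Suc (m \<epsilon>)"
            then show "stochastic (P (n \<epsilon> - k) \<epsilon>)"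
              using P m_less_n[of \<epsilon>] elim by simp
            show "matrix_norm (P (n \<epsilon> - k) \<epsilon> - (Pt - (\<epsilon> * real k) *\<^sub>R P1)) \<le> c * (\<epsilon>\<^sup>2 * (real (m \<epsilon>))\<^sup>2)"
              using elim k by simp
          qed (use elim le orbit in blast)+
          then show ?thesis by (simp add: f_def)
        next
          case False
          then show ?thesis using coarse[of \<epsilon> 1] elim by simp
        qed
        then show ?case
          by (elim disjE) (erule order_trans, rule mult_right_mono, auto)+
      qed
      then show ?thesis by (rule that)
    qed
  next
    case False
    then obtain x where x: "(P1 *v 1) $ x \<noteq> 0" by (auto simp: vec_eq_iff)
    (* As P_{n-m} and Pt have row sums 1, the hypothesis at k = m gives \<epsilon> m |P1 1| = O(\<epsilon>^2 m^2),
       so \<epsilon> m is bounded below. *)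
    define \<eta> where "\<eta> = \<bar>(P1 *v 1) $ x\<bar> / c"
    have "eventually (\<lambda>\<epsilon>. \<not> \<epsilon> * real (m \<epsilon>) < \<eta>) (at_right 0)"
      using approx m_large pos
    proof eventually_elim
      case (elim \<epsilon>)
      let ?e = "\<epsilon> * real (m \<epsilon>)"
      let ?R = "P (n \<epsilon> - m \<epsilon>) \<epsilon> - (Pt - ?e *\<^sub>R P1)"
      have e0: "?e > 0" using elim by simp
      have "stochastic (P (n \<epsilon> - m \<epsilon>) \<epsilon>)" using P m_less_n[of \<epsilon>] elim by simp
      then have "?R *v 1 = ?e *\<^sub>R (P1 *v 1)"
        by (simp add: matrix_vector_mult_diff_rdistrib stochastic_mult_1[OF assms(7)] stochastic_mult_1
           scaleR_matrix_vector_assoc)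
      then have "?e * \<bar>(P1 *v 1) $ x\<bar> = \<bar>(?R *v 1) $ x\<bar>" using e0 elim by (simp add: abs_mult)
      also have "\<dots> \<le> l1_norm (?R $ x)"
        unfolding l1_norm_def matrix_vector_mult_def by (simp add: sum_abs)
      also have "\<dots> \<le> c * (\<epsilon>\<^sup>2 * (real (m \<epsilon>))\<^sup>2)"
        using l1_norm_row_le[of ?R x] elim(1)[rule_format, of "m \<epsilon>"] by simp
      also have "\<dots> = ?e * (c * ?e)" by (simp add: power2_eq_square)
      finally have "\<bar>(P1 *v 1) $ x\<bar> / c \<le> ?e"
        using mult_le_cancel_left_pos[OF e0] c by (simp add: divide_le_eq mult.commute[of _ c])
      then show ?case by (simp add: \<eta>_def)
    qed
    then have "eventually (\<lambda>\<epsilon>. l1_norm (f \<epsilon>) \<le> (2 + l1_norm w) / \<eta>\<^sup>2 * (\<epsilon>\<^sup>2 * real (m \<epsilon>) ^ 3)) (at_right 0)"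
      using m_large pos
      by eventually_elim (use x c in \<open>intro coarse; simp add: \<eta>_def\<close>)
    then show ?thesis by (rule that)
  qed
  then have "eventually (\<lambda>\<epsilon>. norm (f \<epsilon> \<bullet> r) \<le> (K * norm r) * norm (\<epsilon>\<^sup>2 * real (m \<epsilon>) ^ 3)) (at_right 0)"
  proof eventually_elim
    case (elim \<epsilon>)
    then show ?case
      using abs_inner_le_l1_norm[of "f \<epsilon>" r] mult_right_mono[OF elim norm_ge_zero[of r]]
      by (simp add: mult_ac)
  qed
  then have "(\<lambda>\<epsilon>. f \<epsilon> \<bullet> r) \<in> O[at_right 0](\<lambda>\<epsilon>. \<epsilon>\<^sup>2 * real (m \<epsilon>) ^ 3)"
    by (rule bigoI)
  moreover have "f \<epsilon> \<bullet> r = (\<mu> v* matrix_prod (\<lambda>k. P k \<epsilon>) (n \<epsilon>)) \<bullet> r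
           - (let \<pi> = stationary_distribution Pt;
                  B = matrix_inv (mat 1 - Pt + rank_one_rows \<pi>)
              in \<pi> \<bullet> r - \<epsilon> * ((\<pi> v* (P1 ** (B ** B) ** Pt)) \<bullet> r))" for \<epsilon>
  proof -
    have "B = matrix_inv (mat 1 - Pt + rank_one_rows \<pi>)" by (simp add: B_def M_def)
    then show ?thesis
      by (simp add: f_def w_def Let_def inner_diff_left inner_add_left flip: \<pi>_def)
  qed
  ultimately show ?thesis by simp
qed

end
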